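(* Let $R$ be a commutative associative ring with unit, let $a,b\in R$ with $a\neq b$, and let $n,k,l$ be integers with $1<l\le k\le n$. Let $A=(a_{ij})_{1\le i,j\le n}$ be the $n\times n$ matrix over $R$ with $a_{ij}=b$ if $-l<j-i<k$ and $a_{ij}=a$ otherwise. Let $p$ be the integer with $n\equiv p\pmod{k+l-1}$ and $0\le p<k+l-1$. Then $$\det A=\begin{cases}(-1)^{\frac{(k-1)(l-1)n}{k+l-1}}(b-a)^{n-1}\left(b+\frac{n-k-l+1}{k+l-1}\,a\right), & p=0,\\[4pt] (-1)^{\frac{(k-1)(l-1)(n-1)}{k+l-1}}(b-a)^{n-1}\left(b+\frac{n-1}{k+l-1}\,a\right), & p=1,\\[4pt] 0, & \text{otherwise.}\end{cases}$$
   Context: In the case $p=0$ the numbers $\frac{n}{k+l-1}$ and $\frac{n-k-l+1}{k+l-1}$ are integers, and in the case $p=1$ the number $\frac{n-1}{k+l-1}$ is an integer; a product of such an integer with $a$ denotes the corresponding integer multiple of $a$ in $R$. *)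

theory Defs
  imports "Jordan_Normal_Form.Determinant" "HOL-Number_Theory.Cong"
begin

text \<open>The index set of a matrix of type \<open>mat\<close> is \<open>{0..<n}\<close> rather than \<open>{1..n}\<close>; the entries
  depend only on the difference \<open>j - i\<close>, so the shift is harmless. That difference is taken in
  \<open>int\<close>, since it may be negative.\<close>

definition band_matrix :: "nat \<Rightarrow> nat \<Rightarrow> nat \<Rightarrow> 'a \<Rightarrow> 'a \<Rightarrow> 'a mat" where
  "band_matrix n k l a b =
     mat n n (\<lambda>(i, j). if - int l < int j - int i \<and> int j - int i < int k then b else a)"

end

theory Submission
  imports Defs
begin

text \<open>Put \<open>m = k + l - 1\<close>. Row \<open>i\<close> of the band matrix carries \<open>b\<close> in the window of \<open>m\<close> columns
  \<open>i - l + 1, \<dots>, i + k - 1\<close> (cut off at the borders), so passing to the next row replaces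
  column \<open>i - l + 1\<close> of the window by column \<open>i + k\<close>, which lies in the same residue class
  modulo \<open>m\<close>. Subtract from every row but the last its successor, and replace every column by the
  sum of itself and all earlier columns in its residue class; neither changes the determinant. The
  differences of rows \<open>i \<ge> l - 1\<close> then become \<open>b - a\<close> times a unit vector and supply the columns
  \<open>0, \<dots>, n - l - 1\<close>, whereas the first \<open>l - 1\<close> rows become \<open>-(b - a)\<close> times the indicator of the
  columns \<open>j \<ge> i + k\<close> congruent to \<open>i + k\<close>
  (lemma \<open>det_band_matrix_eq_reduced\<close>). Among the last \<open>l\<close> columns, the entry of the last row in
  column \<open>j\<close> is \<open>b + (j div m) a\<close> (\<open>reduced_band_matrix_last_row\<close>). Moving the
  unit rows to the top costs the sign \<open>(-1) ^ ((n - l) (l - 1))\<close>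
  (\<open>det_reduced_band_matrix_eq_swapped\<close>).

  What remains depends on where the residues \<open>k, \<dots>, m - 1\<close> of the moved rows fall among the \<open>l\<close>
  residues of the columns \<open>n - l, \<dots>, n - 1\<close>. If \<open>n\<close> is \<open>1\<close> modulo \<open>m\<close>, they are the first
  \<open>l - 1\<close> of these and the matrix is lower triangular. If \<open>n\<close> is \<open>0\<close> modulo \<open>m\<close>, they are the last
  \<open>l - 1\<close>, and the matrix is lower triangular once column \<open>n - l\<close> is moved to the end. Otherwise one
  of them is missed; the row with that residue is supported on the columns before \<open>n - l\<close>, so it is
  minus a sum of unit rows, and the determinant vanishes. In the first two cases the corner entry
  gives the coefficient of \<open>a\<close>, and a parity count identifies the sign.\<close>

section \<open>Determinants over commutative rings\<close>

lemma det_mat_right_unitriangular: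
  fixes g u :: "nat \<Rightarrow> nat \<Rightarrow> 'a :: comm_ring_1"
  assumes diag: "\<And>i. i < n \<Longrightarrow> u i i = 1"
    and upper: "\<And>i j. j < i \<Longrightarrow> i < n \<Longrightarrow> u i j = 0"
  shows "det (mat n n (\<lambda>(i, j). \<Sum>t = 0..<n. g i t * u t j)) = det (mat n n (\<lambda>(i, j). g i j))"
proof -
  let ?U = "mat n n (\<lambda>(i, j). u i j)" and ?G = "mat n n (\<lambda>(i, j). g i j)"
  have "det ?U = prod_list (diag_mat ?U)"
    by (rule det_upper_triangular[of _ n]) (auto simp: upper)
  also have "\<dots> = 1"
    by (simp add: prod_list_diag_prod diag)
  finally have "det (?G * ?U) = det ?G"
    by (simp add: det_mult[of _ n])
  moreover have "mat n n (\<lambda>(i, j). \<Sum>t = 0..<n. g i t * u t j) = ?G * ?U"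
    by (rule eq_matI) (auto simp: scalar_prod_def)
  ultimately show ?thesis by simp
qed

lemma det_mat_left_unitriangular:
  fixes g u :: "nat \<Rightarrow> nat \<Rightarrow> 'a :: comm_ring_1"
  assumes diag: "\<And>i. i < n \<Longrightarrow> u i i = 1"
    and upper: "\<And>i j. j < i \<Longrightarrow> i < n \<Longrightarrow> u i j = 0"
  shows "det (mat n n (\<lambda>(i, j). \<Sum>t = 0..<n. u i t * g t j)) = det (mat n n (\<lambda>(i, j). g i j))"
proof -
  let ?U = "mat n n (\<lambda>(i, j). u i j)" and ?G = "mat n n (\<lambda>(i, j). g i j)"
  have "det ?U = prod_list (diag_mat ?U)"
    by (rule det_upper_triangular[of _ n]) (auto simp: upper)
  also have "\<dots> = 1"
    by (simp add: prod_list_diag_prod diag)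
  finally have "det (?U * ?G) = det ?G"
    by (simp add: det_mult[of _ n])
  moreover have "mat n n (\<lambda>(i, j). \<Sum>t = 0..<n. u i t * g t j) = ?U * ?G"
    by (rule eq_matI) (auto simp: scalar_prod_def)
  ultimately show ?thesis by simp
qed

lemma det_mat_subtract_next_row:
  fixes g :: "nat \<Rightarrow> nat \<Rightarrow> 'a :: comm_ring_1"
  shows "det (mat n n (\<lambda>(i, j). if Suc i < n then g i j - g (Suc i) j else g i j)) =
    det (mat n n (\<lambda>(i, j). g i j))"
proof -
  define u :: "nat \<Rightarrow> nat \<Rightarrow> 'a" where
    "u = (\<lambda>i t. of_bool (t = i) - of_bool (t = Suc i))"
  have "(\<Sum>t = 0..<n. u i t * g t j) = (if Suc i < n then g i j - g (Suc i) j else g i j)"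
    if "i < n" for i j
  proof -
    have "u i t * g t j = (if t = i then g t j else 0) - (if t = Suc i then g t j else 0)" for t
      by (simp add: u_def)
    then show ?thesis
      using that by (simp add: sum_subtractf)
  qed
  then have "mat n n (\<lambda>(i, j). if Suc i < n then g i j - g (Suc i) j else g i j) =
      mat n n (\<lambda>(i, j). \<Sum>t = 0..<n. u i t * g t j)"
    by (intro eq_matI) auto
  moreover have "det (mat n n (\<lambda>(i, j). \<Sum>t = 0..<n. u i t * g t j)) =
      det (mat n n (\<lambda>(i, j). g i j))"
    by (rule det_mat_left_unitriangular) (auto simp: u_def)
  ultimately show ?thesis by simp
qed

lemma det_mat_accumulate_cols:
  fixes g :: "nat \<Rightarrow> nat \<Rightarrow> 'a :: comm_ring_1"
  shows "det (mat n n (\<lambda>(i, j). \<Sum>t | t \<le> j \<and> [t = j] (mod m). g i t)) =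
    det (mat n n (\<lambda>(i, j). g i j))"
proof -
  define u :: "nat \<Rightarrow> nat \<Rightarrow> 'a" where
    "u = (\<lambda>t j. of_bool (t \<le> j \<and> [t = j] (mod m)))"
  have "(\<Sum>t = 0..<n. g i t * u t j) = (\<Sum>t | t \<le> j \<and> [t = j] (mod m). g i t)"
    if "j < n" for i j
    using that by (intro sum.mono_neutral_cong_right) (auto simp: u_def)
  then have "mat n n (\<lambda>(i, j). \<Sum>t | t \<le> j \<and> [t = j] (mod m). g i t) =
      mat n n (\<lambda>(i, j). \<Sum>t = 0..<n. g i t * u t j)"
    by (intro eq_matI) auto
  moreover have "det (mat n n (\<lambda>(i, j). \<Sum>t = 0..<n. g i t * u t j)) =
      det (mat n n (\<lambda>(i, j). g i j))"
    by (rule det_mat_right_unitriangular) (auto simp: u_def)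
  ultimately show ?thesis by simp
qed

text \<open>Zero divisors are allowed, which is why some entry of the vector has to be \<open>1\<close>:
  multiplying the kernel relation by the adjugate shows that \<open>det A\<close> times the vector is zero.\<close>

lemma det_eq_0_if_left_kernel:
  fixes A :: "'a :: comm_ring_1 mat"
  assumes A: "A \<in> carrier_mat n n" and r: "r < n" "v r = 1"
    and ker: "\<And>j. j < n \<Longrightarrow> (\<Sum>i = 0..<n. v i * A $$ (i, j)) = 0"
  shows "det A = 0"
proof -
  let ?V = "mat 1 n (\<lambda>(_, i). v i)"
  have "?V * A = 0\<^sub>m 1 n"
    using A ker by (intro eq_matI) (auto simp: scalar_prod_def)
  then have "0\<^sub>m 1 n = ?V * A * adj_mat A"
    using adj_mat(1)[OF A] by simp
  also have "\<dots> = ?V * (det A \<cdot>\<^sub>m 1\<^sub>m n)"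
    using adj_mat[OF A] A by (simp add: assoc_mult_mat[of _ 1 n _ n _ n])
  also have "\<dots> = det A \<cdot>\<^sub>m ?V"
    by (subst mult_smult_distrib[of _ 1 n _ n]) auto
  finally have "0\<^sub>m 1 n $$ (0, r) = (det A \<cdot>\<^sub>m ?V) $$ (0, r)"
    by simp
  then show ?thesis using r by simp
qed

section \<open>Subtracting rows and accumulating columns\<close>

text \<open>The band matrix after both operations. The branches are the last row, the rows
  \<open>l - 1, \<dots>, n - 2\<close>, and the first \<open>l - 1\<close> rows. In the last row the original entries, which are
  \<open>b\<close> exactly in the columns from \<open>n - l\<close> on, are still to be summed over the residue class.\<close>

definition reduced_band_matrix :: "nat \<Rightarrow> nat \<Rightarrow> nat \<Rightarrow> 'a \<Rightarrow> 'a \<Rightarrow> 'a :: comm_ring_1 mat" where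
  "reduced_band_matrix n k l a b = mat n n (\<lambda>(i, j).
     if Suc i = n then \<Sum>t | t \<le> j \<and> [t = j] (mod (k + l - 1)). if n - l \<le> t then b else a
     else if l \<le> Suc i then (b - a) * of_bool (j = Suc i - l)
     else - (b - a) * of_bool (i + k \<le> j \<and> [i + k = j] (mod (k + l - 1))))"

lemma cong_nat_ge_cases:
  fixes s j m :: nat
  assumes "s \<le> j" "[s = j] (mod m)"
  shows "j = s \<or> s + m \<le> j"
proof (cases "j = s")
  case False
  from assms have "m dvd j - s"
    by (simp add: cong_altdef_nat cong_sym_eq)
  with assms False have "m \<le> j - s"
    by (intro dvd_imp_le) auto
  with assms show ?thesis by linarith
qed simp

lemma det_band_matrix_eq_reduced:
  fixes a b :: "'a :: comm_ring_1"
  assumes "1 < l" "l \<le> n" "1 < k"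
  shows "det (band_matrix n k l a b) = det (reduced_band_matrix n k l a b)"
proof -
  define m where "m = k + l - 1"
  define e where "e = (\<lambda>i j :: nat. if i < j + l \<and> j < i + k then b else a)"
  define f where "f = (\<lambda>i j. \<Sum>t | t \<le> j \<and> [t = j] (mod m). e i t)"
  have m: "m > 0" using assms by (simp add: m_def)
  have "band_matrix n k l a b = mat n n (\<lambda>(i, j). e i j)"
    by (intro eq_matI) (auto simp: band_matrix_def e_def)
  then have "det (band_matrix n k l a b) = det (mat n n (\<lambda>(i, j). f i j))"
    unfolding f_def by (simp add: det_mat_accumulate_cols)
  also have "\<dots> = det (mat n n (\<lambda>(i, j). if Suc i < n then f i j - f (Suc i) j else f i j))"
    by (rule det_mat_subtract_next_row[symmetric])
  also have "mat n n (\<lambda>(i, j). if Suc i < n then f i j - f (Suc i) j else f i j) =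
      reduced_band_matrix n k l a b"
  proof (rule eq_matI)
    fix i j assume "i < dim_row (reduced_band_matrix n k l a b)"
      and "j < dim_col (reduced_band_matrix n k l a b)"
    then have ij: "i < n" "j < n" by (auto simp: reduced_band_matrix_def)
    let ?c = "b - a"
    show "mat n n (\<lambda>(i, j). if Suc i < n then f i j - f (Suc i) j else f i j) $$ (i, j) =
        reduced_band_matrix n k l a b $$ (i, j)"
    proof (cases "Suc i = n")
      case True
      have "e i t = (if n - l \<le> t then b else a)" if "t \<le> j" for t
        using True that ij assms by (auto simp: e_def)
      then show ?thesis
        using True ij by (auto simp: reduced_band_matrix_def f_def m_def intro!: sum.cong)
    next
      case False
      have fin: "finite {t. t \<le> j \<and> [t = j] (mod m)}" by simp
      \<comment> \<open>The window loses column \<open>i - l + 1\<close> and gains column \<open>i + k\<close>.\<close>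
      have step: "e i t - e (Suc i) t = ?c * of_bool (Suc i = t + l) - ?c * of_bool (t = i + k)" for t
        using assms by (auto simp: e_def)
      have first: "(\<Sum>t | t \<le> j \<and> [t = j] (mod m). ?c * of_bool (Suc i = t + l)) =
          ?c * of_bool (l \<le> Suc i \<and> Suc i - l \<le> j \<and> [Suc i - l = j] (mod m))"
      proof (cases "l \<le> Suc i")
        case True
        then have "Suc i = t + l \<longleftrightarrow> t = Suc i - l" for t by auto
        then show ?thesis using True fin
          by (auto simp: of_bool_def if_distrib sum.delta' cong: if_cong)
      qed (auto intro!: sum.neutral)
      have second: "(\<Sum>t | t \<le> j \<and> [t = j] (mod m). ?c * of_bool (t = i + k)) =
          ?c * of_bool (i + k \<le> j \<and> [i + k = j] (mod m))"
        using fin by (auto simp: of_bool_def if_distrib cong: if_cong)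
      have "f i j - f (Suc i) j =
          ?c * of_bool (l \<le> Suc i \<and> Suc i - l \<le> j \<and> [Suc i - l = j] (mod m)) -
          ?c * of_bool (i + k \<le> j \<and> [i + k = j] (mod m))"
        unfolding f_def sum_subtractf[symmetric] step
        by (simp only: sum_subtractf first second)
      also have "\<dots> = (if l \<le> Suc i then ?c * of_bool (j = Suc i - l)
          else - ?c * of_bool (i + k \<le> j \<and> [i + k = j] (mod m)))"
      proof (cases "l \<le> Suc i")
        case True
        \<comment> \<open>The two columns are \<open>s\<close> and \<open>s + m\<close>, so the two class sums cancel except in column \<open>s\<close>.\<close>
        define s where "s = Suc i - l"
        have sk: "i + k = s + m" using True assms by (simp add: s_def m_def)
        have "[s + m = j] (mod m) \<longleftrightarrow> [s = j] (mod m)"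
          by (simp add: cong_def)
        moreover have "\<not> s + m \<le> s" using m by simp
        ultimately show ?thesis
          using True cong_nat_ge_cases[of s j m] unfolding sk s_def[symmetric] by auto
      qed auto
      finally show ?thesis
        using False ij by (simp add: reduced_band_matrix_def m_def)
    qed
  qed (auto simp: reduced_band_matrix_def)
  finally show ?thesis .
qed

text \<open>Since \<open>l < m\<close>, the residue class of such a column \<open>j\<close> meets the columns \<open>n - l, \<dots>, j\<close> only in
  \<open>j\<close> itself; the other \<open>j div m\<close> summands are \<open>a\<close>.\<close>

lemma reduced_band_matrix_last_row:
  assumes "n - l \<le> j" "j < n" "1 < l" "l \<le> n" "1 < k"
  shows "reduced_band_matrix n k l a b $$ (n - 1, j) = b + of_nat (j div (k + l - 1)) * a"
proof -
  define m where "m = k + l - 1"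
  have m: "m > 0" "l < m" using assms by (auto simp: m_def)
  let ?S = "{t. t \<le> j \<and> [t = j] (mod m)}"
  have card: "card ?S = Suc (j div m)"
  proof -
    have "bij_betw (\<lambda>q. j mod m + q * m) {..j div m} ?S"
    proof (rule bij_betwI[where g = "\<lambda>t. t div m"])
      show "(\<lambda>q. j mod m + q * m) \<in> {..j div m} \<rightarrow> ?S"
      proof safe
        fix q assume "q \<le> j div m"
        then have "q * m \<le> j div m * m" by simp
        then show "j mod m + q * m \<le> j"
          using div_mult_mod_eq[of j m] by linarith
      qed (simp add: cong_def)
      show "(\<lambda>t. t div m) \<in> ?S \<rightarrow> {..j div m}"
        by (auto simp: div_le_mono)
    qed (use m in \<open>auto simp: cong_def\<close>, metis mod_div_mult_eq)
    from bij_betw_same_card[OF this] show ?thesis by simp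
  qed
  have only: "t = j" if "t \<in> ?S" "n - l \<le> t" for t
    using that cong_nat_ge_cases[of t j m] m assms by auto
  have "(\<Sum>t\<in>?S. if n - l \<le> t then b else a) = b + (\<Sum>t\<in>?S - {j}. if n - l \<le> t then b else a)"
    using assms(1) by (subst sum.remove[of _ j]) auto
  also have "(\<Sum>t\<in>?S - {j}. if n - l \<le> t then b else a) = (\<Sum>t\<in>?S - {j}. a)"
    using only by (intro sum.cong) auto
  also have "\<dots> = of_nat (j div m) * a"
    using card by (simp add: card_Diff_singleton)
  finally show ?thesis
    using assms by (simp add: reduced_band_matrix_def m_def)
qed

section \<open>Moving the unit rows to the top\<close>

text \<open>The reduced matrix with its first \<open>l - 1\<close> rows moved behind the \<open>n - l\<close> unit rows. Row \<open>i\<close> of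
  the middle part is row \<open>i - (n - l)\<close> of the reduced matrix; the conditions \<open>i - (n - l) + k \<le> j\<close>
  and \<open>i - (n - l) + k\<close> congruent to \<open>j\<close> are written without subtraction.\<close>

definition swapped_band_matrix :: "nat \<Rightarrow> nat \<Rightarrow> nat \<Rightarrow> 'a \<Rightarrow> 'a \<Rightarrow> 'a :: comm_ring_1 mat" where
  "swapped_band_matrix n k l a b = mat n n (\<lambda>(i, j).
      if i < n - l then (b - a) * of_bool (j = i)
      else if i < n - 1 then - (b - a) *
        of_bool (i + l + k \<le> j + n \<and> [i + l + k = j + n] (mod (k + l - 1)))
      else reduced_band_matrix n k l a b $$ (n - 1, j))"

lemma swapped_band_matrix_carrier: "swapped_band_matrix n k l a b \<in> carrier_mat n n"
  by (simp add: swapped_band_matrix_def)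

lemma swapped_band_matrix_top:
  "i < n - l \<Longrightarrow> j < n \<Longrightarrow> swapped_band_matrix n k l a b $$ (i, j) = (b - a) * of_bool (j = i)"
  by (simp add: swapped_band_matrix_def)

lemma swapped_band_matrix_middle:
  "n - l \<le> i \<Longrightarrow> i < n - 1 \<Longrightarrow> j < n \<Longrightarrow> swapped_band_matrix n k l a b $$ (i, j) =
    - (b - a) * of_bool (i + l + k \<le> j + n \<and> [i + l + k = j + n] (mod (k + l - 1)))"
  by (simp add: swapped_band_matrix_def)

lemma det_reduced_band_matrix_eq_swapped:
  fixes a b :: "'a :: comm_ring_1"
  assumes "1 < l" "l \<le> n"
  shows "det (reduced_band_matrix n k l a b) = (- 1) ^ ((n - l) * (l - 1)) *
    det (swapped_band_matrix n k l a b)"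
proof -
  let ?B = "reduced_band_matrix n k l a b"
  have shift: "[i + l - n + k = j] (mod m) \<longleftrightarrow> [i + l + k = j + n] (mod m)"
    if "n \<le> i + l" for i j m :: nat
  proof -
    have "i + l + k = i + l - n + k + n" using that by simp
    then show ?thesis by (metis cong_add_rcancel_nat)
  qed
  have "det ?B = (- 1) ^ ((l - 1) * (n - l)) * det (mat n n (\<lambda>(i, j).
      ?B $$ (if i < n - l then i + (l - 1) else if i < l - 1 + (n - l) then i - (n - l) else i, j)))"
    by (rule det_swap_initial_rows) (use assms in \<open>auto simp: reduced_band_matrix_def\<close>)
  also have "mat n n (\<lambda>(i, j).
      ?B $$ (if i < n - l then i + (l - 1) else if i < l - 1 + (n - l) then i - (n - l) else i, j)) =
    swapped_band_matrix n k l a b" (is "?L = ?R")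
  proof (rule eq_matI)
    fix i j assume "i < dim_row ?R" "j < dim_col ?R"
    then have ij: "i < n" "j < n" by (auto simp: swapped_band_matrix_def)
    consider "i < n - l" | "n - l \<le> i" "i < n - 1" | "i = n - 1" using ij by linarith
    then show "?L $$ (i, j) = ?R $$ (i, j)"
    proof cases
      case 2
      then have "i - (n - l) + k \<le> j \<longleftrightarrow> i + l + k \<le> j + n" 
        using assms by linarith
      then show ?thesis
        using 2 ij assms shift[of i j]
          by (auto simp: reduced_band_matrix_def swapped_band_matrix_def)
    qed (use ij assms in \<open>auto simp: reduced_band_matrix_def swapped_band_matrix_def\<close>)
  qed (auto simp: swapped_band_matrix_def)
  finally show ?thesis by (simp add: mult.commute)
qed

section \<open>The three residue cases\<close>

lemma det_lower_triangular_last: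
  fixes A :: "'a :: comm_ring_1 mat"
  assumes A: "A \<in> carrier_mat n n" and l: "0 < l" "l \<le> n"
    and upper: "\<And>i j. i < j \<Longrightarrow> j < n \<Longrightarrow> A $$ (i, j) = 0"
    and diag: "\<And>i. i < n - l \<Longrightarrow> A $$ (i, i) = c"
      "\<And>i. n - l \<le> i \<Longrightarrow> i < n - 1 \<Longrightarrow> A $$ (i, i) = - c"
  shows "det A = (- 1) ^ (l - 1) * c ^ (n - 1) * A $$ (n - 1, n - 1)"
proof -
  have "det A = (\<Prod>i = 0..<n. A $$ (i, i))"
    using det_lower_triangular[OF upper A] A by (simp add: prod_list_diag_prod)
  also have "\<dots> = (\<Prod>i = 0..<n - 1. A $$ (i, i)) * A $$ (n - 1, n - 1)"
    using l by (cases n) simp_all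
  also have "(\<Prod>i = 0..<n - 1. A $$ (i, i)) =
      (\<Prod>i = 0..<n - l. A $$ (i, i)) * (\<Prod>i = n - l..<n - 1. A $$ (i, i))"
    using l by (intro prod.atLeastLessThan_concat[symmetric]) auto
  also have "\<dots> = c ^ (n - l) * (- c) ^ (l - 1)"
    using l diag by simp
  also have "\<dots> = (- 1) ^ (l - 1) * c ^ (n - 1)"
  proof -
    have "n - 1 = (n - l) + (l - 1)" using l by simp
    then show ?thesis by (simp add: power_minus[of c] power_add mult_ac)
  qed
  finally show ?thesis .
qed

text \<open>The missed residue is \<open>s = max k p\<close>, the one of row \<open>s - k\<close> before the swap: from
  \<open>p \<le> s < p + m - l\<close> it follows that no column from \<open>n - l\<close> on is congruent to \<open>s\<close>.\<close>

lemma det_swapped_band_matrix_residue_ge_2: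
  fixes a b :: "'a :: comm_ring_1"
  assumes "1 < l" "l \<le> n" "1 < k" and n: "n = q * (k + l - 1) + p" and p: "1 < p" "p < k + l - 1"
  shows "det (swapped_band_matrix n k l a b) = 0"
proof -
  define m where "m = k + l - 1"
  define s where "s = max k p"
  define r where "r = n - l + (s - k)"
  define v :: "nat \<Rightarrow> 'a" where
    "v = (\<lambda>i. of_bool (i = r \<or> i < n - l \<and> s \<le> i \<and> [s = i] (mod m)))"
  let ?C = "swapped_band_matrix n k l a b"
  have nm: "n = q * m + p" using n by (simp add: m_def)
  have s: "p \<le> s" "s + l < p + m" using assms by (auto simp: s_def m_def)
  have r: "n - l \<le> r" "r < n - 1"
    using assms by (auto simp: r_def s_def)
  \<comment> \<open>Already \<open>s + q m \<ge> n\<close>, while \<open>s + (q - 1) m < n - l\<close>; the comparison avoids \<open>q - 1\<close>.\<close>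
  have left: "j < n - l" if "s \<le> j" "[s = j] (mod m)" "j < n" for j
  proof (rule ccontr)
    assume "\<not> j < n - l"
    have "m dvd j - s"
      using that by (simp add: cong_altdef_nat cong_sym_eq)
    then obtain t where "j - s = m * t" ..
    then have t: "j = s + t * m"
      using that(1) by (simp add: mult.commute)
    show False
    proof (cases "q \<le> t")
      case True
      then have "q * m \<le> t * m" by simp
      then show False using t that(3) nm s(1) by linarith
    next
      case False
      then have "(t + 1) * m \<le> q * m" by (intro mult_right_mono) auto
      then have "t * m + m \<le> q * m" by simp
      then show False using t nm s(2) \<open>\<not> j < n - l\<close> by linarith
    qed
  qed
  have row: "?C $$ (r, j) = - (b - a) * of_bool (s \<le> j \<and> [s = j] (mod m))" if "j < n" for j
  proof -
    have "r + l + k = s + n" using assms by (auto simp: r_def s_def)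
    then show ?thesis
      using r that by (simp add: swapped_band_matrix_def m_def cong_add_rcancel_nat)
  qed
  show ?thesis
  proof (rule det_eq_0_if_left_kernel[where v = v and r = r and n = n])
    fix j assume j: "j < n"
    have "(\<Sum>i = 0..<n. v i * ?C $$ (i, j)) =
        ?C $$ (r, j) + (\<Sum>i \<in> {0..<n} - {r}. v i * ?C $$ (i, j))"
      using r by (subst sum.remove[of _ r]) (auto simp: v_def)
    also have "(\<Sum>i \<in> {0..<n} - {r}. v i * ?C $$ (i, j)) =
        (\<Sum>i \<in> {0..<n} - {r}. if i = j then (b - a) * of_bool (j < n - l \<and> s \<le> j \<and> [s = j] (mod m)) else 0)"
      using j r by (intro sum.cong) (auto simp: v_def swapped_band_matrix_def)
    also have "\<dots> = (b - a) * of_bool (s \<le> j \<and> [s = j] (mod m))"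
      using left[OF _ _ j] j r by auto
    finally show "(\<Sum>i = 0..<n. v i * ?C $$ (i, j)) = 0"
      using row[OF j] by simp
  qed (use r in \<open>auto simp: v_def swapped_band_matrix_def\<close>)
qed

lemma swapped_band_matrix_last_row:
  assumes "n - l \<le> j" "j < n" "1 < l" "l \<le> n" "1 < k"
  shows "swapped_band_matrix n k l a b $$ (n - 1, j) = b + of_nat (j div (k + l - 1)) * a"
proof -
  have "\<not> n - 1 < n - l" using assms by linarith
  then show ?thesis
    using assms(2) reduced_band_matrix_last_row[OF assms, of a b]
    by (simp add: swapped_band_matrix_def)
qed

lemma det_swapped_band_matrix_residue_1:
  fixes a b :: "'a :: comm_ring_1"
  assumes "1 < l" "1 < k" and q: "0 < q" and n: "n = q * (k + l - 1) + 1"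
  shows "det (swapped_band_matrix n k l a b) = (- 1) ^ (l - 1) * (b - a) ^ (n - 1) * (b + of_nat q * a)"
proof -
  define m where "m = k + l - 1"
  have nm: "n = q * m + 1" and mkl: "m + 1 = k + l"
    using n assms by (simp_all add: m_def)
  have "m \<le> q * m" using q by simp
  then have ln: "k + l \<le> n" "l < m" using nm mkl assms(1,2) by linarith+
  have cong: "[i + l + k = j + n] (mod m) \<longleftrightarrow> [i = j] (mod m)" for i j
  proof -
    have eq: "i + l + k = (i + m) + 1" "j + n = (j + q * m) + 1"
      using nm mkl by linarith+
    show ?thesis
      unfolding eq cong_add_rcancel_nat by (simp add: cong_def)
  qed
  let ?C = "swapped_band_matrix n k l a b"
  have middle: "?C $$ (i, j) = - (b - a) * of_bool (i + l + k \<le> j + n \<and> [i = j] (mod m))"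
    if "n - l \<le> i" "i < n - 1" "j < n" for i j
    using swapped_band_matrix_middle[OF that, of k a b] by (simp only: cong flip: m_def)
  have "det ?C = (- 1) ^ (l - 1) * (b - a) ^ (n - 1) * ?C $$ (n - 1, n - 1)"
  proof (rule det_lower_triangular_last)
    fix i j assume ij: "i < j" "j < n"
    have "\<not> [i = j] (mod m)" if "n - l \<le> i"
      using cong_nat_ge_cases[of i j m] ij that ln by auto
    then show "?C $$ (i, j) = 0"
      using ij middle[of i j] by (cases "i < n - l") (auto simp: swapped_band_matrix_top)
  next
    fix i assume "n - l \<le> i" "i < n - 1"
    then show "?C $$ (i, i) = - (b - a)"
      using middle[of i i] ln by simp
  qed (use ln assms(1,2) in \<open>auto simp: swapped_band_matrix_top swapped_band_matrix_carrier\<close>)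
  also have "?C $$ (n - 1, n - 1) = b + of_nat ((n - 1) div m) * a"
    unfolding m_def using ln assms(1,2) by (intro swapped_band_matrix_last_row) auto
  also have "(n - 1) div m = q"
    using n ln by (simp add: m_def)
  finally show ?thesis .
qed

lemma det_swapped_band_matrix_residue_0:
  fixes a b :: "'a :: comm_ring_1"
  assumes "1 < l" "1 < k" and q: "0 < q" and n: "n = q * (k + l - 1)"
  shows "det (swapped_band_matrix n k l a b) = (b - a) ^ (n - 1) * (b + of_nat (q - 1) * a)"
proof -
  define m where "m = k + l - 1"
  have nm: "n = q * m" and mkl: "m + 1 = k + l"
    using n assms by (simp_all add: m_def)
  have "m \<le> q * m" using q by simp
  then have ln: "k + l \<le> n + 1" "l < m" using nm mkl assms(1,2) by linarith+
  have cong: "[i + l + k = j + n] (mod m) \<longleftrightarrow> [Suc i = j] (mod m)" for i j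
  proof -
    have eq: "i + l + k = Suc i + m" "j + n = j + q * m"
      using nm mkl by linarith+
    show ?thesis
      unfolding eq cong_def mod_add_self2 mod_mult_self3 mod_mult_self1 ..
  qed
  let ?C = "swapped_band_matrix n k l a b"
  have middle: "?C $$ (i, j) = - (b - a) * of_bool (i + l + k \<le> j + n \<and> [Suc i = j] (mod m))"
    if "n - l \<le> i" "i < n - 1" "j < n" for i j
    using swapped_band_matrix_middle[OF that, of k a b] by (simp only: cong flip: m_def)
  \<comment> \<open>Column \<open>n - l\<close> goes to the end, and the columns behind it move one place to the left.\<close>
  define D where "D = mat n n (\<lambda>(i, j).
    ?C $$ (i, if j < n - l then j else if j < n - 1 then Suc j else n - l))"
  have "det ?C = (- 1) ^ (1 * (l - 1)) * det (mat n n (\<lambda>(i, j).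
    ?C $$ (i, if j < n - l then j else if j < n - l + (l - 1) then j + 1 else j - (l - 1))))"
    by (rule det_swap_final_cols) (use ln assms in \<open>auto simp: swapped_band_matrix_def\<close>)
  also have "mat n n (\<lambda>(i, j).
    ?C $$ (i, if j < n - l then j else if j < n - l + (l - 1) then j + 1 else j - (l - 1))) = D"
    unfolding D_def
  proof (intro cong_mat refl, unfold prod.case)
    fix i j assume "i < n" "j < n"
    then have "(if j < n - l then j else if j < n - l + (l - 1) then j + 1 else j - (l - 1)) =
        (if j < n - l then j else if j < n - 1 then Suc j else n - l)"
      using ln assms(1,2) by auto
    then show "?C $$ (i, if j < n - l then j else if j < n - l + (l - 1) then j + 1 else j - (l - 1)) =
      ?C $$ (i, if j < n - l then j else if j < n - 1 then Suc j else n - l)"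
      by (simp only:)
  qed
  also have "det D = (- 1) ^ (l - 1) * (b - a) ^ (n - 1) * D $$ (n - 1, n - 1)"
  proof (rule det_lower_triangular_last)
    fix i j assume ij: "i < j" "j < n"
    show "D $$ (i, j) = 0"
    proof (cases "i < n - l")
      case True
      then show ?thesis using ij assms(1,2) ln by (auto simp: D_def swapped_band_matrix_top)
    next
      case False
      \<comment> \<open>Column \<open>j\<close> of \<open>D\<close> is column \<open>j + 1\<close> of the swapped matrix, or column \<open>n - l\<close> if \<open>j = n - 1\<close>.\<close>
      have 1: "\<not> [Suc i = Suc j] (mod m)"
        using cong_nat_ge_cases[of "Suc i" "Suc j" m] ij False ln by auto
      have 2: "\<not> [Suc i = n - l] (mod m)"
        using cong_nat_ge_cases[of "n - l" "Suc i" m] ij False ln by (auto simp: cong_sym_eq)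
      show ?thesis
        using ij False assms(1,2) ln 1 2 by (auto simp: D_def middle)
    qed
  next
    fix i assume "n - l \<le> i" "i < n - 1"
    then show "D $$ (i, i) = - (b - a)"
      using middle[of i "Suc i"] ln by (simp add: D_def)
  qed (use ln assms(1,2) in \<open>auto simp: D_def swapped_band_matrix_top\<close>)
  also have "D $$ (n - 1, n - 1) = ?C $$ (n - 1, n - l)"
    using ln assms(1,2) by (auto simp: D_def)
  also have "\<dots> = b + of_nat ((n - l) div m) * a"
    unfolding m_def using ln assms(1,2) by (intro swapped_band_matrix_last_row) auto
  also have "(n - l) div m = q - 1"
  proof -
    obtain q' where "q = Suc q'" using q by (cases q) auto
    then have "n - l = k - 1 + q' * m" using n assms by (simp add: m_def)
    moreover have "k - 1 < m" using mkl assms(1,2) by linarith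
    ultimately show ?thesis using \<open>q = Suc q'\<close> by simp
  qed
  \<comment> \<open>The sign of the column shift and the signs on the diagonal cancel.\<close>
  finally show ?thesis
    by (simp add: mult.assoc[symmetric] flip: power_mult_distrib)
qed

section \<open>The determinant\<close>

theorem theorem1p2:
  fixes a b :: "'a :: comm_ring_1" and n k l p :: nat
  assumes "a \<noteq> b"
    and "1 < l" and "l \<le> k" and "k \<le> n"
    and "[n = p] (mod (k + l - 1))" and "p < k + l - 1"
  shows "det (band_matrix n k l a b) =
    (if p = 0 then
       (- 1) ^ (((k - 1) * (l - 1) * n) div (k + l - 1)) * (b - a) ^ (n - 1) *
         (b + of_int ((int n - int k - int l + 1) div (int k + int l - 1)) * a)
     else if p = 1 then
       (- 1) ^ (((k - 1) * (l - 1) * (n - 1)) div (k + l - 1)) * (b - a) ^ (n - 1) *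
         (b + of_int ((int n - 1) div (int k + int l - 1)) * a)
     else 0)"
proof -
  define m where "m = k + l - 1"
  define q where "q = n div m"
  have kl: "1 < l" "1 < k" "l \<le> n" using assms by auto
  have "n mod m = p" using assms by (simp add: cong_def m_def)
  then have n: "n = q * m + p" unfolding q_def by (metis div_mult_mod_eq)
  have m: "m > 0" "int m = int k + int l - 1" using kl by (auto simp: m_def)
  have det: "det (band_matrix n k l a b) =
      (- 1) ^ ((n - l) * (l - 1)) * det (swapped_band_matrix n k l a b)"
    using det_band_matrix_eq_reduced[of l n k a b] det_reduced_band_matrix_eq_swapped[of l n k a b] kl
    by simp
  \<comment> \<open>Both signs depend only on parities, and \<open>n - l\<close> has the parity of \<open>q m + p + l\<close>.\<close>
  obtain k' where k': "k = Suc k'" using kl by (cases k) auto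
  obtain l' where l': "l = Suc l'" using kl by (cases l) auto
  have qpos: "0 < q" if "p < 2"
    using that n assms kl by (cases q) auto
  have par: "even (n - l + l) = even (q * (k + l - 1) + p)"
    using n kl by (simp add: m_def)
  consider "p = 0" | "p = 1" | "1 < p" by linarith
  then show ?thesis
  proof cases
    case 1
    have "(k - 1) * (l - 1) * n div m = (k - 1) * (l - 1) * q"
      using n 1 m by simp
    moreover have "even ((n - l) * (l - 1)) \<longleftrightarrow> even ((k - 1) * (l - 1) * q)"
      using par 1 by (auto simp: k' l')
    ultimately have sign: "(- 1 :: 'a) ^ ((n - l) * (l - 1)) = (- 1) ^ ((k - 1) * (l - 1) * n div m)"
      by (simp add: minus_one_power_iff)
    have "int n - int k - int l + 1 = int (q - 1) * int m"
      using n 1 qpos m(2) by (simp add: of_nat_diff left_diff_distrib)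
    then have "(int n - int k - int l + 1) div (int k + int l - 1) = int (q - 1)"
      using m(1) unfolding m(2)[symmetric] by simp
    moreover have "det (swapped_band_matrix n k l a b) = (b - a) ^ (n - 1) * (b + of_nat (q - 1) * a)"
      using det_swapped_band_matrix_residue_0[of l k q n a b] n 1 qpos kl by (simp add: m_def)
    ultimately show ?thesis
      unfolding det sign using 1 by (simp add: m_def mult.assoc)
  next
    case 2
    have "(k - 1) * (l - 1) * (n - 1) div m = (k - 1) * (l - 1) * q"
      using n 2 m by simp
    moreover have "even ((n - l) * (l - 1) + (l - 1)) \<longleftrightarrow> even ((k - 1) * (l - 1) * q)"
      using par 2 by (auto simp: k' l')
    ultimately have sign: "(- 1 :: 'a) ^ ((n - l) * (l - 1)) * (- 1) ^ (l - 1) =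
        (- 1) ^ ((k - 1) * (l - 1) * (n - 1) div m)"
      by (subst power_add[symmetric]) (simp only: minus_one_power_iff)
    have "(int n - 1) div (int k + int l - 1) = int q"
      using n 2 m(1) unfolding m(2)[symmetric] by simp
    moreover have "det (swapped_band_matrix n k l a b) =
        (- 1) ^ (l - 1) * ((b - a) ^ (n - 1) * (b + of_nat q * a))"
      using det_swapped_band_matrix_residue_1[of l k q n a b] n 2 qpos kl by (simp add: m_def mult.assoc)
    ultimately show ?thesis
      unfolding det using 2 sign by (simp add: m_def mult.assoc[symmetric])
  next
    case 3
    have "det (swapped_band_matrix n k l a b) = 0"
      by (rule det_swapped_band_matrix_residue_ge_2) (use 3 n[unfolded m_def] kl assms(6) in auto)
    then show ?thesis
      unfolding det using 3 by simp
  qed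
qed

end
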